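(* Let $c \geq 1$ be a constant. There exist a constant $\kappa > 0$ and a threshold $N$ such that for all integers $n, d \geq N$, every formula of fan-in at most $c$ that computes $\mathrm{OV}_{n,d}$ has size at least $$\kappa \cdot \min\left\{\frac{n^2}{\log d},\ \frac{n \cdot 2^d}{d^{1/2}\log d}\right\}.$$ (Equivalently: for all sufficiently large $n,d$, $\mathrm{OV}_{n,d}$ does not have fan-in-$c$ formulas of size $O(\min\{n^2/\log d,\ n 2^d/(d^{1/2}\log d)\})$.)
   Context: The Orthogonal Vectors function $\mathrm{OV}_{n,d}:\{0,1\}^{nd}\to\{0,1\}$ takes $n$ vectors $v_1,\ldots,v_n \in \{0,1\}^d$ (given as $nd$ Boolean input variables $v_{i,k}$) and outputs $1$ iff there exist indices $i,j$ with $\langle v_i, v_j\rangle = \sum_{k=1}^d v_{i,k}v_{j,k} = 0$. A formula of fan-in $c$ is a rooted tree whose leaves are labeled by input variables or constants and whose internal nodes (gates) compute arbitrary Boolean functions of at most $c$ inputs (i.e. any complete basis of gates of fan-in at most $c$); its size is its number of nodes. *)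

theory Defs
  imports Complex_Main
begin

text \<open>A gate carries an arbitrary Boolean function, which is applied to the list of values of its
  children; only its behaviour on lists of that length matters.\<close>

datatype 'v formula =
    Var 'v
  | Const bool
  | Gate "bool list \<Rightarrow> bool" "'v formula list"

primrec eval_formula :: "('v \<Rightarrow> bool) \<Rightarrow> 'v formula \<Rightarrow> bool" where
  "eval_formula x (Var v) = x v"
| "eval_formula x (Const b) = b"
| "eval_formula x (Gate g fs) = g (map (eval_formula x) fs)"

primrec num_nodes :: "'v formula \<Rightarrow> nat" where
  "num_nodes (Var v) = 1"
| "num_nodes (Const b) = 1"
| "num_nodes (Gate g fs) = 1 + sum_list (map num_nodes fs)"

text \<open>Gates are the internal nodes of the tree, so they have at least one child.\<close>

primrec fan_in_at_most :: "nat \<Rightarrow> 'v formula \<Rightarrow> bool" where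
  "fan_in_at_most c (Var v) = True"
| "fan_in_at_most c (Const b) = True"
| "fan_in_at_most c (Gate g fs) =
     (fs \<noteq> [] \<and> length fs \<le> c \<and> list_all (fan_in_at_most c) fs)"

text \<open>The input variable \<open>(i, k)\<close> is the \<open>k\<close>-th coordinate of the \<open>i\<close>-th vector, with indices
  starting at 0. The indices of the orthogonal pair are not required to be distinct; for
  \<open>n \<ge> 2\<close> this makes no difference, since only the zero vector is orthogonal to itself, and it is
  orthogonal to every vector.\<close>

definition OV :: "nat \<Rightarrow> nat \<Rightarrow> (nat \<times> nat \<Rightarrow> bool) \<Rightarrow> bool" where
  "OV n d v \<longleftrightarrow>
     (\<exists>i<n. \<exists>j<n. (\<Sum>k<d. of_bool (v (i, k)) * of_bool (v (j, k))) = (0::nat))"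

text \<open>Leaves may only use the \<open>n * d\<close> actual input variables. Assignments are total functions, but
  then neither side of the equation depends on their values outside these variables.\<close>

definition computes_OV :: "nat \<Rightarrow> nat \<Rightarrow> (nat \<times> nat) formula \<Rightarrow> bool" where
  "computes_OV n d F \<longleftrightarrow>
     set_formula F \<subseteq> {..<n} \<times> {..<d} \<and> (\<forall>v. eval_formula v F = OV n d v)"

end

theory Submission
  imports Defs "HOL-Library.Cardinality" "HOL-Library.Disjoint_Sets"
begin

text \<open>Nechiporuk's method, with one block of variables for each vector. If a block has \<open>l > 0\<close>
  leaves in a formula of fan-in \<open>c\<close>, then fixing all other variables leaves at most
  \<open>2 ^ O(c l)\<close> different functions of the block. For the block of \<open>v\<^sub>i\<close>, choose distinct sets of
  size \<open>t = d div 2 + 1\<close>, which pairwise intersect, and give each of the other vectors either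
  one of these sets or the all-ones vector. Probing \<open>v\<^sub>i\<close> with the complement of one of the sets
  tells whether this set is in use, so \<open>m = min (n - 1) (d choose t)\<close> sets yield \<open>2 ^ m\<close>
  functions. Hence every block has \<open>\<Omega>(m)\<close> leaves, and \<open>d choose t\<close> is of order \<open>2 ^ d / sqrt d\<close>.\<close>

section \<open>Leaves and subfunctions belonging to a block of variables\<close>

primrec occurrences :: "'v set \<Rightarrow> 'v formula \<Rightarrow> nat" where
  "occurrences S (Var v) = of_bool (v \<in> S)"
| "occurrences S (Const b) = 0"
| "occurrences S (Gate g fs) = sum_list (map (occurrences S) fs)"

text \<open>Closing under the unary \<open>h\<close> lets a gate with a single child that depends on \<open>S\<close> be absorbed
  into that child.\<close>

definition subfunctions :: "'v set \<Rightarrow> 'v formula \<Rightarrow> (('v \<Rightarrow> bool) \<Rightarrow> bool) set" where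
  "subfunctions S F = {\<lambda>x. h (eval_formula (override_on \<rho> x S) F) | (h :: bool \<Rightarrow> bool) \<rho>. True}"

text \<open>The variable at a leaf lies in at most one of the disjoint sets, so no leaf is counted
  twice.\<close>

lemma sum_occurrences_le_num_nodes:
  assumes "finite I" "disjoint_family_on A I"
  shows "(\<Sum>i\<in>I. occurrences (A i) F) \<le> num_nodes F"
proof (induction F)
  case (Var v)
  have "card {i \<in> I. v \<in> A i} \<le> Suc 0"
    using assms by (subst card_le_Suc0_iff_eq) (auto simp: disjoint_family_on_def)
  then show ?case
    using assms(1) by (simp add: of_bool_def sum.If_cases Int_def)
next
  case (Gate g fs)
  have "(\<Sum>i\<in>I. sum_list (map (occurrences (A i)) fs)) = (\<Sum>f\<leftarrow>fs. \<Sum>i\<in>I. occurrences (A i) f)"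
    by (induction fs) (auto simp: sum.distrib)
  also have "\<dots> \<le> (\<Sum>f\<leftarrow>fs. num_nodes f)"
    using Gate by (intro sum_list_mono) auto
  finally show ?case
    by simp
qed simp

section \<open>Upper bound on the number of subfunctions\<close>

lemma eval_formula_override_on:
  "occurrences S F = 0 \<Longrightarrow> eval_formula (override_on \<rho> x S) F = eval_formula \<rho> F"
proof (induction F)
  case (Gate g fs)
  then have "map (eval_formula (override_on \<rho> x S)) fs = map (eval_formula \<rho>) fs"
    by (intro map_cong) auto
  then show ?case
    by (simp only: eval_formula.simps)
qed (auto simp: override_on_def)

lemma finite_card_le_length:
  assumes "A \<subseteq> set xs"
  shows "finite A \<and> card A \<le> length xs"
  using assms card_length[of xs] card_mono[of "set xs" A] finite_subset[of A "set xs"] by auto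

lemma card_subfunctions_no_occurrences:
  assumes "occurrences S F = 0"
  shows "finite (subfunctions S F) \<and> card (subfunctions S F) \<le> 2"
proof -
  have "subfunctions S F \<subseteq> set [\<lambda>_. True, \<lambda>_. False]"
    using assms by (auto simp: subfunctions_def eval_formula_override_on)
  from finite_card_le_length[OF this] show ?thesis
    by simp
qed

lemma card_subfunctions_Var: "finite (subfunctions S (Var v)) \<and> card (subfunctions S (Var v)) \<le> 4"
proof -
  have "\<phi> \<in> set [\<lambda>_. True, \<lambda>_. False, \<lambda>x. x v, \<lambda>x. \<not> x v]"
    if "\<phi> \<in> subfunctions S (Var v)" for \<phi>
  proof -
    from that obtain h \<rho> where "\<phi> = (\<lambda>x. h (override_on \<rho> x S v))"
      by (auto simp: subfunctions_def)
    moreover have "h b = (if b then h True else h False)" for b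
      by (cases b) auto
    ultimately have \<phi>: "\<phi> = (\<lambda>x. if override_on \<rho> x S v then h True else h False)"
      by metis
    show ?thesis
      unfolding \<phi> by (cases "h True"; cases "h False"; cases "\<rho> v"; cases "v \<in> S")
        (auto simp: override_on_def fun_eq_iff)
  qed
  then have "subfunctions S (Var v) \<subseteq> set [\<lambda>_. True, \<lambda>_. False, \<lambda>x. x v, \<lambda>x. \<not> x v]"
    by blast
  from finite_card_le_length[OF this] show ?thesis
    by simp
qed

text \<open>Once \<rho> is fixed, all children except child \<open>j\<close> are constants. The gate
  then acts on child \<open>j\<close> as a unary function, which merges with
  \<open>h\<close>.\<close>

lemma subfunctions_Gate_single:
  assumes "j < length fs" "\<And>i. i < length fs \<Longrightarrow> i \<noteq> j \<Longrightarrow> occurrences S (fs ! i) = 0"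
  shows "subfunctions S (Gate g fs) \<subseteq> subfunctions S (fs ! j)"
proof
  fix \<phi> assume "\<phi> \<in> subfunctions S (Gate g fs)"
  then obtain h \<rho> where \<phi>: "\<phi> = (\<lambda>x. h (g (map (eval_formula (override_on \<rho> x S)) fs)))"
    by (auto simp: subfunctions_def)
  have *: "map (eval_formula (override_on \<rho> x S)) fs
      = (map (eval_formula \<rho>) fs)[j := eval_formula (override_on \<rho> x S) (fs ! j)]" for x
    using assms by (intro nth_equalityI) (auto simp: nth_list_update eval_formula_override_on)
  show "\<phi> \<in> subfunctions S (fs ! j)"
    unfolding \<phi> * subfunctions_def
    by (intro CollectI exI[of _ "\<lambda>b. h (g ((map (eval_formula \<rho>) fs)[j := b]))"] exI[of _ \<rho>]) simp
qed

lemma finite_card_listset: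
  "(\<And>A. A \<in> set As \<Longrightarrow> finite A) \<Longrightarrow> finite (listset As) \<and> card (listset As) = (\<Prod>A\<leftarrow>As. card A)"
proof (induction As)
  case (Cons A As)
  have eq: "listset (A # As) = (\<lambda>(x, xs). x # xs) ` (A \<times> listset As)"
    by (auto simp: set_Cons_def)
  have "inj_on (\<lambda>(x, xs). x # xs) (A \<times> listset As)"
    by (auto simp: inj_on_def)
  then show ?case
    unfolding eq using Cons by (auto simp: card_image card_cartesian_product)
qed simp

lemma map_in_listset: "(\<And>x. x \<in> set xs \<Longrightarrow> f x \<in> A x) \<Longrightarrow> map f xs \<in> listset (map A xs)"
  by (induction xs) (auto simp: set_Cons_def)

text \<open>A subfunction of the gate is determined by \<open>h\<close> and one subfunction of each
  child. The factor 4 counts the choices of \<open>h\<close>.\<close>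

lemma card_subfunctions_Gate:
  assumes "\<And>f. f \<in> set fs \<Longrightarrow> finite (subfunctions S f)"
  shows "finite (subfunctions S (Gate g fs))"
    and "card (subfunctions S (Gate g fs)) \<le> 4 * (\<Prod>f\<leftarrow>fs. card (subfunctions S f))"
proof -
  let ?L = "listset (map (subfunctions S) fs)"
  let ?c = "\<lambda>(h :: bool \<Rightarrow> bool, \<phi>s). \<lambda>x. h (g (map (\<lambda>\<phi>. \<phi> x) \<phi>s))"
  have fin: "finite ?L" and card: "card ?L = (\<Prod>f\<leftarrow>fs. card (subfunctions S f))"
    using finite_card_listset[of "map (subfunctions S) fs"] assms by (auto simp: o_def)
  have sub: "subfunctions S (Gate g fs) \<subseteq> ?c ` (UNIV \<times> ?L)"
  proof
    fix \<phi> assume "\<phi> \<in> subfunctions S (Gate g fs)"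
    then obtain h \<rho> where \<phi>: "\<phi> = (\<lambda>x. h (g (map (eval_formula (override_on \<rho> x S)) fs)))"
      by (auto simp: subfunctions_def)
    let ?\<phi>s = "map (\<lambda>f x. eval_formula (override_on \<rho> x S) f) fs"
    have "?\<phi>s \<in> ?L"
      by (intro map_in_listset) (auto simp: subfunctions_def intro!: exI[of _ "\<lambda>b. b"])
    moreover have "\<phi> = ?c (h, ?\<phi>s)"
      by (simp add: \<phi> o_def)
    ultimately show "\<phi> \<in> ?c ` (UNIV \<times> ?L)"
      by blast
  qed
  have fin': "finite ((UNIV :: (bool \<Rightarrow> bool) set) \<times> ?L)"
    using fin by simp
  have "card (UNIV :: (bool \<Rightarrow> bool) set) = 4"
    by (simp add: card_fun)
  then have "card ((UNIV :: (bool \<Rightarrow> bool) set) \<times> ?L) = 4 * (\<Prod>f\<leftarrow>fs. card (subfunctions S f))"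
    using card by (simp add: card_cartesian_product)
  then show "finite (subfunctions S (Gate g fs))"
    and "card (subfunctions S (Gate g fs)) \<le> 4 * (\<Prod>f\<leftarrow>fs. card (subfunctions S f))"
    using sub surj_card_le[OF fin' sub] finite_subset[OF sub] fin' by auto
qed

lemma prod_list_le_power_sum_list:
  fixes b :: nat
  assumes "\<And>x. x \<in> set xs \<Longrightarrow> f x \<le> b ^ e x"
  shows "(\<Prod>x\<leftarrow>xs. f x) \<le> b ^ (\<Sum>x\<leftarrow>xs. e x)"
  using assms by (induction xs) (auto simp: power_add intro!: mult_mono)

text \<open>Nechiporuk's counting: only gates with at least two children that depend on \<open>S\<close> multiply the
  number of subfunctions, and there are fewer such gates than occurrences of variables of \<open>S\<close>.\<close>

lemma card_subfunctions_le:
  assumes "fan_in_at_most c F"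
  shows "finite (subfunctions S F) \<and> card (subfunctions S F) \<le>
    2 ^ (if occurrences S F = 0 then 1 else (c + 2) * (2 * occurrences S F - 1))"
  using assms
proof (induction F)
  case (Var v)
  show ?case
  proof (cases "v \<in> S")
    case True
    \<comment> \<open>A single occurrence gives the exponent \<open>c + 2\<close>, and 2 ^ (c + 2) =
      4 * 2 ^ c.\<close>
    have "k \<le> 4 * 2 ^ c" if "k \<le> 4" for k :: nat
      using that le_trans[of k 4 "4 * 2 ^ c"] by simp
    then show ?thesis
      using True card_subfunctions_Var[of S v] by auto
  next
    case False
    then show ?thesis
      using card_subfunctions_no_occurrences[of S "Var v"] by simp
  qed
next
  case (Const b)
  show ?case
    using card_subfunctions_no_occurrences[of S "Const b"] by simp
next
  case (Gate g fs)
  let ?e = "\<lambda>f. if occurrences S f = 0 then 1 else (c + 2) * (2 * occurrences S f - 1)"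
  have IH: "finite (subfunctions S f)" "card (subfunctions S f) \<le> 2 ^ ?e f" if "f \<in> set fs" for f
    using Gate that by (auto simp: list_all_iff)
  let ?P = "{i. i < length fs \<and> occurrences S (fs ! i) \<noteq> 0}"
  consider "?P = {}" | j where "?P = {j}" | "card ?P \<ge> 2"
  proof -
    have "card ?P = 0 \<or> card ?P = 1 \<or> card ?P \<ge> 2"
      by linarith
    then show ?thesis
      using that by (auto simp: card_1_singleton_iff)
  qed
  then show ?case
  proof cases
    case 1
    then have "occurrences S (Gate g fs) = 0"
      by (auto simp: sum_list_eq_0_iff in_set_conv_nth)
    then show ?thesis
      using card_subfunctions_no_occurrences[of S "Gate g fs"] by simp
  next
    case 2
    then have j: "j < length fs" "occurrences S (fs ! j) \<noteq> 0"
      and z: "\<And>i. i < length fs \<Longrightarrow> i \<noteq> j \<Longrightarrow> occurrences S (fs ! i) = 0"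
      by blast+
    have "(\<Sum>i<length fs. occurrences S (fs ! i)) = (\<Sum>i\<in>{j}. occurrences S (fs ! i))"
      using j z by (intro sum.mono_neutral_right) auto
    then have occ: "occurrences S (Gate g fs) = occurrences S (fs ! j)"
      by (simp add: sum_list_sum_nth atLeast0LessThan)
    have sub: "subfunctions S (Gate g fs) \<subseteq> subfunctions S (fs ! j)"
      using j z by (intro subfunctions_Gate_single)
    show ?thesis
      unfolding occ using IH[OF nth_mem[OF j(1)]] finite_subset[OF sub] card_mono[OF _ sub]
      by (meson le_trans)
  next
    case 3
    let ?p = "length (filter (\<lambda>f. occurrences S f \<noteq> 0) fs)"
    have p: "?p \<ge> 2"
      using 3 by (simp add: length_filter_conv_card)
    let ?l = "sum_list (map (occurrences S) fs)"
    have l: "?l \<noteq> 0"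
    proof
      assume "?l = 0"
      then have "filter (\<lambda>f. occurrences S f \<noteq> 0) fs = []"
        by (auto simp: filter_empty_conv)
      then have "?p = 0"
        by (simp only: list.size)
      then show False
        using p by linarith
    qed
    have arith: "2 + s \<le> r"
      if "s + p \<le> k + q" "(c + 2) * 2 \<le> p" "k \<le> c" "r + (c + 2) = q" for s p k q r :: nat
      using that by (simp add: algebra_simps)
    \<comment> \<open>Each dependent child stays \<open>c + 2\<close> below
      \<open>(c + 2) * (2 * occurrences S f)\<close>, and the independent children cost 1 each, at
      most \<open>c\<close> in total. Two dependent children thus save \<open>2 * (c + 2)\<close>:
      one half becomes the \<open>- 1\<close> in the bound for the gate, the other pays for the
      independent children and for the factor 4 = 2 ^ 2.\<close>
    have "sum_list (map ?e fs) + (c + 2) * ?p \<le> length fs + (c + 2) * (2 * ?l)"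
    proof (induction fs)
      case (Cons f fs)
      have "?e f + (c + 2) * of_bool (occurrences S f \<noteq> 0) \<le> 1 + (c + 2) * (2 * occurrences S f)"
        by (cases "occurrences S f") (auto simp: algebra_simps)
      moreover have "length (filter (\<lambda>f. occurrences S f \<noteq> 0) (f # fs))
          = of_bool (occurrences S f \<noteq> 0) + length (filter (\<lambda>f. occurrences S f \<noteq> 0) fs)"
        by simp
      ultimately show ?case
        using Cons.IH by (simp only: list.map sum_list.Cons list.size distrib_left)
    qed simp
    moreover have "(c + 2) * 2 \<le> (c + 2) * ?p"
      using p by (intro mult_left_mono) auto
    moreover have "length fs \<le> c"
      using Gate.prems by simp
    moreover have "(c + 2) * (2 * ?l - 1) + (c + 2) = (c + 2) * (2 * ?l)"
      using l by (cases ?l) (auto simp: algebra_simps)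
    ultimately have e: "2 + sum_list (map ?e fs) \<le> (c + 2) * (2 * ?l - 1)"
      by (rule arith)
    have "(\<Prod>f\<leftarrow>fs. card (subfunctions S f)) \<le> 2 ^ sum_list (map ?e fs)"
      using IH(2) by (rule prod_list_le_power_sum_list)
    then have "4 * (\<Prod>f\<leftarrow>fs. card (subfunctions S f)) \<le> 2 ^ (2 + sum_list (map ?e fs))"
      by (simp add: power_add)
    also have "\<dots> \<le> 2 ^ ((c + 2) * (2 * ?l - 1))"
      using e by (intro power_increasing) auto
    finally have "card (subfunctions S (Gate g fs)) \<le> 2 ^ ((c + 2) * (2 * ?l - 1))"
      using card_subfunctions_Gate(2)[of fs S g] IH(1) le_trans by blast
    then show ?thesis
      unfolding occurrences.simps if_not_P[OF l] using card_subfunctions_Gate(1) IH(1) by blast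
  qed
qed

section \<open>Binomial coefficients near the centre\<close>

text \<open>This is 4 ^ k / (2 sqrt k) \<le> (2k choose k), squared to stay within the naturals. The
  induction uses the ratio 2 (2k + 1) / (k + 1) of consecutive central coefficients and 4k (k + 1)
  \<le> (2k + 1)^2.\<close>

lemma central_binomial_square_lower_bound:
  "k \<ge> 1 \<Longrightarrow> 16 ^ k \<le> 4 * k * (2 * k choose k)\<^sup>2"
proof (induction k rule: nat_induct_at_least)
  case (Suc k)
  define C where "C = (2 * k choose k)"
  define D where "D = (2 * Suc k choose Suc k)"
  have "(k + 1) * D = 2 * ((2 * k + 1) * C)"
  proof -
    have "Suc k * (Suc (2 * k + 1) choose Suc k) = Suc (2 * k + 1) * (2 * k + 1 choose k)"
      by (rule Suc_times_binomial)
    moreover have "(k + 1) * (2 * k + 1 choose k) = (2 * k + 1) * C"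
      using binomial_absorb_comp[of "2 * k + 1" k] by (simp add: C_def)
    ultimately show ?thesis
      by (simp add: D_def algebra_simps)
  qed
  then have "((k + 1) * D)\<^sup>2 = (2 * ((2 * k + 1) * C))\<^sup>2"
    by simp
  then have D: "(k + 1) * ((k + 1) * D\<^sup>2) = 4 * (2 * k + 1)\<^sup>2 * C\<^sup>2"
    by (simp add: power2_eq_square algebra_simps)
  have "(k + 1) * 16 ^ Suc k = (k + 1) * 16 * 16 ^ k"
    by (simp add: algebra_simps)
  also have "\<dots> \<le> (k + 1) * 16 * (4 * k * C\<^sup>2)"
    unfolding C_def using Suc.IH by (rule mult_left_mono) simp
  also have "\<dots> \<le> 16 * (2 * k + 1)\<^sup>2 * C\<^sup>2"
    by (simp add: power2_eq_square algebra_simps)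
  also have "\<dots> = 4 * (4 * (2 * k + 1)\<^sup>2 * C\<^sup>2)"
    by simp
  also have "\<dots> = (k + 1) * (4 * ((k + 1) * D\<^sup>2))"
    unfolding D[symmetric] by (simp only: mult.left_commute)
  finally have "(k + 1) * 16 ^ Suc k \<le> (k + 1) * (4 * ((k + 1) * D\<^sup>2))" .
  then have "16 ^ Suc k \<le> 4 * ((k + 1) * D\<^sup>2)"
    by (rule mult_left_le_imp_le) simp
  then show ?case
    unfolding D_def Suc_eq_plus1 mult.assoc .
qed simp

lemma near_central_binomial_lower_bound:
  assumes "d \<ge> 2"
  shows "2 ^ d / (8 * sqrt d) \<le> real (d choose (d div 2 + 1))"
proof -
  define k where "k = d div 2"
  define C where "C = (2 * k choose k)"
  have k: "k \<ge> 1" "k \<le> d" "d \<le> 2 * k + 1"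
    using assms by (auto simp: k_def)
  \<comment> \<open>For even \<open>d\<close> the coefficient next to the centre is k / (k + 1)
    \<ge> 1/2 times \<open>C\<close>; for odd \<open>d\<close>, Pascal's rule makes \<open>C\<close>
    one of its two summands.\<close>
  have "C \<le> 2 * (d choose (k + 1))"
  proof (cases "even d")
    case True
    have "(k + 1) * (2 * k choose (k + 1)) = k * C"
      using binomial_absorb_comp[of "2 * k" k] binomial_absorption[of k "2 * k"]
      unfolding C_def by (metis Suc_eq_plus1 add_diff_cancel_left' mult_2)
    moreover have "(k + 1) * C \<le> 2 * (k * C)"
      using k(1) by (simp add: algebra_simps)
    ultimately have "(k + 1) * C \<le> (k + 1) * (2 * (2 * k choose (k + 1)))"
      by (simp only: mult.left_commute)
    then have "C \<le> 2 * (2 * k choose (k + 1))"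
      by (rule mult_left_le_imp_le) simp
    then show ?thesis
      using True by (simp add: k_def)
  next
    case False
    then have "d = Suc (2 * k)"
      by (simp add: k_def)
    then show ?thesis
      by (simp add: C_def)
  qed
  then have "real C / 2 \<le> real (d choose (k + 1))"
    by linarith
  \<comment> \<open>After squaring, one factor 4 comes from \<open>d \<le> 2 * k + 1\<close> and the
    other from the central bound; together they give the constant 4 = sqrt 16.\<close>
  moreover have "2 ^ d / (4 * sqrt d) \<le> real C"
  proof (rule power2_le_imp_le)
    have "(2 :: real) ^ d \<le> 2 ^ (2 * k + 1)"
      using k by (intro power_increasing) auto
    then have "((2 :: real) ^ d)\<^sup>2 \<le> (2 ^ (2 * k + 1))\<^sup>2"
      by (intro power_mono) auto
    also have "\<dots> = 4 * 16 ^ k"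
      by (simp add: power_mult power2_eq_square flip: power_mult_distrib)
    also have "16 ^ k \<le> 4 * real k * (real C)\<^sup>2"
      using central_binomial_square_lower_bound[OF k(1)] unfolding C_def
      by (metis (mono_tags) of_nat_le_iff of_nat_mult of_nat_numeral of_nat_power)
    also have "\<dots> \<le> 4 * real d * (real C)\<^sup>2"
      using k by (intro mult_right_mono) auto
    finally show "(2 ^ d / (4 * sqrt d))\<^sup>2 \<le> (real C)\<^sup>2"
      using assms by (simp add: power_divide power_mult_distrib divide_le_eq algebra_simps)
  qed simp
  ultimately show ?thesis
    by (simp add: k_def)
qed

section \<open>Lower bound on the number of subfunctions of orthogonal vectors\<close>

lemma card_subfunctions_OV_ge:
  assumes F: "\<And>v. eval_formula v F = OV n d v" and fin: "finite (subfunctions ({i} \<times> UNIV) F)"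
    and "i < n" "d \<ge> 3" "m \<le> n - 1" "m \<le> d choose (d div 2 + 1)"
  shows "2 ^ m \<le> card (subfunctions ({i} \<times> UNIV) F)"
proof -
  let ?t = "d div 2 + 1" and ?S = "{i} \<times> (UNIV :: nat set)"
  let ?W = "{A. A \<subseteq> {..<d} \<and> card A = ?t}"
  have "m \<le> card ({..<n} - {i})"
    using assms by simp
  then obtain J where J: "J \<subseteq> {..<n} - {i}" "card J = m" "finite J"
    by (rule obtain_subset_with_card_n)
  have "finite ?W" "card ?W = d choose ?t"
    by (auto simp: n_subsets)
  then obtain w where w: "w ` J \<subseteq> ?W" "inj_on w J"
    using J assms card_le_inj[of J ?W] by auto
  have finw: "finite (w a)" if "a \<in> J" for a
    using w(1) that finite_subset[of "w a" "{..<d}"] by auto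
  \<comment> \<open>Any two of the sets have total size more than \<open>d\<close>, hence meet.\<close>
  have meet: "w a \<inter> w b \<noteq> {}" if "a \<in> J" "b \<in> J" for a b
  proof
    assume "w a \<inter> w b = {}"
    then have "card (w a \<union> w b) = card (w a) + card (w b)"
      using finw that by (intro card_Un_disjoint) auto
    moreover have "card (w a) = ?t" "card (w b) = ?t"
      using w(1) that by auto
    moreover have "card (w a \<union> w b) \<le> card {..<d}"
      using w(1) that by (intro card_mono) auto
    ultimately show False
      by simp
  qed
  \<comment> \<open>Subsets \<open>T\<close> of \<open>J\<close> are encoded in the vectors outside
    the block. The all-ones vector serves as the neutral choice because it is orthogonal to the zero
    vector only.\<close>
  define V where "V T j = (if j \<in> T then w j else {..<d})" for T j
  define \<rho> where "\<rho> T = (\<lambda>(j, k). k \<in> V T j)" for T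
  define \<Phi> where "\<Phi> T = (\<lambda>x. eval_formula (override_on (\<rho> T) x ?S) F)" for T
  define X where "X a = (\<lambda>(j :: nat, k). k \<notin> w a)" for a
  have OV_iff: "OV n d v \<longleftrightarrow> (\<exists>i<n. \<exists>j<n. \<forall>k<d. \<not> (v (i, k) \<and> v (j, k)))" for v
    by (auto simp: OV_def disjoint_iff intro!: ex_cong)
  have \<Phi>: "\<Phi> T (X a) \<longleftrightarrow> a \<in> T" if "T \<subseteq> J" "a \<in> J" for T a
  proof -
    define U where "U j = (if j = i then {..<d} - w a else V T j)" for j
    have U: "override_on (\<rho> T) (X a) ?S (j, k) \<longleftrightarrow> k \<in> U j" if "k < d" for j k
      using that by (auto simp: override_on_def \<rho>_def X_def U_def)
    have Vd: "V T j \<subseteq> {..<d}" for j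
      using w(1) that(1) by (auto simp: V_def)
    then have Ud: "U j \<subseteq> {..<d}" for j
      by (auto simp: U_def)
    have "(\<forall>k<d. \<not> (k \<in> U j \<and> k \<in> U l)) \<longleftrightarrow> U j \<inter> U l = {}" for j l
      using Ud[of j] by blast
    then have "\<Phi> T (X a) \<longleftrightarrow> (\<exists>j<n. \<exists>l<n. U j \<inter> U l = {})"
      unfolding \<Phi>_def F OV_iff by (simp add: U cong: conj_cong)
    also have "\<dots> \<longleftrightarrow> a \<in> T"
    proof
      assume "a \<in> T"
      then have "U a \<inter> U i = {}" "a < n"
        using J(1) that by (auto simp: U_def V_def)
      then show "\<exists>j<n. \<exists>l<n. U j \<inter> U l = {}"
        using \<open>i < n\<close> by blast
    next
      assume "\<exists>j<n. \<exists>l<n. U j \<inter> U l = {}"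
      then obtain j l where jl: "U j \<inter> U l = {}"
        by blast
      \<comment> \<open>From \<open>d \<ge> 3\<close> it follows that \<open>?t < d\<close>, so the
        probe is nonzero and not orthogonal to itself.\<close>
      have wa: "w a \<subset> {..<d}" "w a \<noteq> {}"
      proof -
        have "card (w a) = ?t" "?t < d"
          using w(1) that \<open>d \<ge> 3\<close> by auto
        then show "w a \<subset> {..<d}" "w a \<noteq> {}"
          using w(1) that by auto
      qed
      \<comment> \<open>Hence an orthogonal pair must involve the probed vector
        \<open>v\<^sub>i\<close>.\<close>
      have VV: "V T p \<inter> V T q \<noteq> {}" for p q
        using meet[of p q] meet[of p p] meet[of q q] w(1) that(1) \<open>d \<ge> 3\<close>
        unfolding V_def by (auto simp: lessThan_empty_iff)
      \<comment> \<open>A vector disjoint from the complement of \<open>w a\<close> is not all-ones,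
        so it is some \<open>w q\<close> contained in \<open>w a\<close>. Equal sizes force
        equality, and injectivity of \<open>w\<close> gives \<open>q = a\<close>.\<close>
      have iV: "a \<in> T" if disj: "({..<d} - w a) \<inter> V T q = {}" for q
      proof -
        have "q \<in> T"
          using disj wa by (auto simp: V_def split: if_splits)
        then have "q \<in> J" "w q \<subseteq> w a"
          using disj Vd[of q] \<open>T \<subseteq> J\<close> by (auto simp: V_def)
        moreover have "card (w q) = ?t" "card (w a) = ?t"
          using w(1) \<open>q \<in> J\<close> \<open>a \<in> J\<close> by auto
        ultimately have "w q = w a"
          using finw \<open>a \<in> J\<close> by (intro card_subset_eq) auto
        then show "a \<in> T"
          using w(2) \<open>q \<in> J\<close> \<open>a \<in> J\<close> \<open>q \<in> T\<close> by (auto dest: inj_onD)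
      qed
      show "a \<in> T"
        using jl VV[of j l] iV[of j] iV[of l] wa(1) by (auto simp: U_def Int_commute split: if_splits)
    qed
    finally show ?thesis .
  qed
  have "inj_on \<Phi> (Pow J)"
  proof (rule inj_onI)
    fix T T' assume "T \<in> Pow J" "T' \<in> Pow J" "\<Phi> T = \<Phi> T'"
    then show "T = T'"
      using \<Phi>[of T] \<Phi>[of T'] by auto
  qed
  then have "card (\<Phi> ` Pow J) = 2 ^ m"
    using J by (simp add: card_image card_Pow)
  moreover have "\<Phi> ` Pow J \<subseteq> subfunctions ?S F"
    by (auto simp: \<Phi>_def subfunctions_def intro!: exI[of _ "\<lambda>b. b"])
  ultimately show ?thesis
    using card_mono[OF fin] by metis
qed

section \<open>From subfunction counts to formula size\<close>

text \<open>Comparing the two counts shows that each block has at least m / (2 (c + 2)) leaves; the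
  blocks are disjoint, so these add up over all \<open>n\<close> vectors.\<close>

lemma OV_formula_lower_bound:
  assumes F: "fan_in_at_most c F" "computes_OV n d F" and "d \<ge> 3"
    and m: "m \<le> n - 1" "m \<le> d choose (d div 2 + 1)" "m \<ge> 2"
  shows "n * m \<le> 2 * (c + 2) * num_nodes F"
proof -
  let ?o = "\<lambda>i. occurrences ({i} \<times> UNIV) F"
  have "m \<le> 2 * (c + 2) * ?o i" if "i < n" for i
  proof -
    have "finite (subfunctions ({i} \<times> UNIV) F)"
      and c: "card (subfunctions ({i} \<times> UNIV) F) \<le>
        2 ^ (if ?o i = 0 then 1 else (c + 2) * (2 * ?o i - 1))"
      using card_subfunctions_le[OF F(1), of "{i} \<times> UNIV"] by auto
    then have "2 ^ m \<le> card (subfunctions ({i} \<times> UNIV) F)"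
      using F(2) assms(3) m that by (intro card_subfunctions_OV_ge) (auto simp: computes_OV_def)
    then have "(2 :: nat) ^ m \<le> 2 ^ (if ?o i = 0 then 1 else (c + 2) * (2 * ?o i - 1))"
      using c by (rule le_trans)
    then have "m \<le> (if ?o i = 0 then 1 else (c + 2) * (2 * ?o i - 1))"
      by (rule power_le_imp_le_exp[rotated]) simp
    \<comment> \<open>A block without leaves would give \<open>m \<le> 1\<close>, contrary to
      \<open>m \<ge> 2\<close>.\<close>
    then have "m \<le> (c + 2) * (2 * ?o i - 1)"
      using m(3) by (auto split: if_splits)
    also have "\<dots> \<le> (c + 2) * (2 * ?o i)"
      by (intro mult_left_mono) auto
    finally show ?thesis
      by (simp add: algebra_simps)
  qed
  then have "(\<Sum>i<n. m) \<le> (\<Sum>i<n. 2 * (c + 2) * ?o i)"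
    by (intro sum_mono) auto
  also have "\<dots> = 2 * (c + 2) * (\<Sum>i<n. ?o i)"
    by (simp add: sum_distrib_left)
  also have "\<dots> \<le> 2 * (c + 2) * num_nodes F"
    by (intro mult_left_mono sum_occurrences_le_num_nodes) (auto simp: disjoint_family_on_def)
  finally show ?thesis
    by simp
qed

theorem theorem1p1:
  fixes c :: nat
  assumes "c \<ge> 1"
  shows "\<exists>\<kappa>::real. \<kappa> > 0 \<and> (\<exists>N::nat. \<forall>n\<ge>N. \<forall>d\<ge>N. \<forall>F :: (nat \<times> nat) formula.
           fan_in_at_most c F \<longrightarrow> computes_OV n d F \<longrightarrow>
           real (num_nodes F) \<ge>
             \<kappa> * min ((real n)\<^sup>2 / log 2 (real d))
                     (real n * 2 ^ d / (sqrt (real d) * log 2 (real d))))"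
proof (intro exI[of _ "1 / (16 * (real c + 2))"] conjI exI[of _ "3 :: nat"] allI impI)
  fix n d F
  assume n: "3 \<le> n" and d: "3 \<le> d" and F: "fan_in_at_most c F" "computes_OV n d F"
  define b where "b = d choose (d div 2 + 1)"
  define m where "m = min (n - 1) b"
  \<comment> \<open>The threshold 3 ensures \<open>m \<ge> 2\<close>: it gives
    \<open>n - 1 \<ge> 2\<close>, and it makes both summands of \<open>b\<close> in Pascal's rule
    positive.\<close>
  have "0 < (d - 1) choose (d div 2)" "0 < (d - 1) choose (d div 2 + 1)"
    using d by auto
  moreover have "b = ((d - 1) choose (d div 2)) + ((d - 1) choose (d div 2 + 1))"
    unfolding b_def using d by (cases d) auto
  ultimately have "b \<ge> 2"
    by linarith
  then have m: "m \<le> n - 1" "m \<le> b" "m \<ge> 2"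
    using n by (auto simp: m_def)
  have "real (n * m) \<le> real (2 * (c + 2) * num_nodes F)"
    using OV_formula_lower_bound[OF F d m(1) _ m(3)] m(2) unfolding b_def of_nat_le_iff by simp
  then have nodes: "real n * real m / (2 * (real c + 2)) \<le> real (num_nodes F)"
    by (simp add: divide_le_eq algebra_simps)
  have log: "1 \<le> log 2 (real d)"
    using d by (simp add: le_log_iff)
  let ?min = "min (real n) (2 ^ d / sqrt d)"
  \<comment> \<open>The 8 comes from the binomial estimate, and \<open>n - 1\<close> is far above
    \<open>n / 8\<close>. Together with the factor \<open>2 * (c + 2)\<close> it yields the constant
    \<open>16 * (c + 2)\<close>.\<close>
  have "?min / 8 \<le> real m"
    using near_central_binomial_lower_bound[of d] d n
    by (auto simp: m_def b_def min_def split: if_splits)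
  then have "real n * (?min / 8) / (2 * (real c + 2)) \<le> real n * real m / (2 * (real c + 2))"
    by (intro divide_right_mono mult_left_mono) auto
  \<comment> \<open>Since \<open>log 2 d\<close> is at least 1, removing it from the denominators
    can only enlarge both terms.\<close>
  moreover have "min ((real n)\<^sup>2 / log 2 d) (real n * 2 ^ d / (sqrt d * log 2 d)) \<le> real n * ?min"
  proof -
    have "(real n)\<^sup>2 / log 2 d \<le> (real n)\<^sup>2 / 1"
      using log by (intro divide_left_mono) auto
    moreover have "real n * 2 ^ d / (sqrt d * log 2 d) \<le> real n * 2 ^ d / (sqrt d * 1)"
      using log d by (intro divide_left_mono mult_left_mono) auto
    ultimately show ?thesis
      by (auto simp: min_def power2_eq_square)
  qed
  then have "1 / (16 * (real c + 2)) *
      min ((real n)\<^sup>2 / log 2 d) (real n * 2 ^ d / (sqrt d * log 2 d))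
      \<le> 1 / (16 * (real c + 2)) * (real n * ?min)"
    by (intro mult_left_mono) auto
  moreover have "1 / (16 * (real c + 2)) * (real n * ?min) = real n * (?min / 8) / (2 * (real c + 2))"
    by simp
  ultimately show "1 / (16 * (real c + 2)) *
      min ((real n)\<^sup>2 / log 2 d) (real n * 2 ^ d / (sqrt d * log 2 d)) \<le> real (num_nodes F)"
    using nodes by linarith
qed simp

end
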